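(* For a $(KN,N)$ non-private coded caching system ($KN$ users, $N$ files) under a demand vector with uniform profile (every file is requested by exactly $K$ of the $KN$ users), the memory-rate pair $$\left(\frac{1}{K(N-1)+1},\; N\left(1-\frac{1}{K(N-1)+1}\right)\right)$$ is achievable for a sufficiently large field. Furthermore, for $M\in\left[0,\frac{1}{K(N-1)+1}\right]$, the rate $$R_{KN,N}(M)=N(1-M)$$ is achievable.
   Context: Notation: $[n]=\{1,\dots,n\}$; $H$ denotes Shannon entropy. Setting: a server with $N$ files $\mathbf{W}=\{W_1,\dots,W_N\}$ is connected to $KN$ users through an error-free broadcast link. The files are independent, each of size $F$ bits and uniformly distributed on $[2^F]$. "For a sufficiently large field" means that the file segments are taken from a finite field of sufficiently large size. Each user $k\in[KN]$ has a local cache of capacity $MF$ bits (normalized capacity $M$), $0\le M\le N$. In the placement phase, when the demands are unknown, the server fills the caches with file contents; the content of user $k$'s cache is denoted $Z_k$. In the delivery phase user $k$ demands file $W_{d_k}$, $d_k\in[N]$, and the server broadcasts to all users a message $X^d$ of size $RF$ bits, depending on the demand vector $\mathbf{d}=(d_1,\dots,d_{KN})$; $R$ is called the rate. The demand vector $\mathbf{d}$ has uniform profile if all files are requested by the same number of users, that is, each $n\in[N]$ occurs exactly $K$ times among $d_1,\dots,d_{KN}$. Here the server makes the placement with the prior knowledge that the demand vector will have uniform profile, but without knowing the demand vector itself. A pair $(M,R)$ is achievable under uniform demand profile if there is a scheme with cache memory $M$ and rate $R$ such that, for demand vectors with uniform profile, every user can decode its demanded file: $H(W_{d_k}\mid Z_k,d_k,X^d)=0$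 for all $k\in[KN]$. No privacy condition is imposed ("non-private"). $R_{KN,N}(M)$ denotes the transmission rate, for cache memory $M$, with which a $(KN,N)$ non-private coded caching scheme satisfies this decodability requirement for all users; in the second part of the claim, as in the first, it is considered under demand vectors with uniform profile.
   Formalization: For irrational M an exact finite scheme of rate N(1-M) is impossible, so for general real M the rate is achieved as N(1-M)+ε for every ε>0 with exact memory M; for rational M, including the corner point, the rate is exact over every sufficiently large finite field. *)

theory Defs
  imports "HOL-Probability.Probability" "HOL-Algebra.Ring"
begin

text \<open>
  A file takes values in a finite set \<open>A\<close>; its size in bits is \<open>F = log 2 (card A)\<close>. For
  \<open>A = {1..2 ^ F}\<close> this is the model of \<open>F\<close>-bit files, and for \<open>A = {1..T} \<rightarrow>\<^sub>E carrier \<FF>\<close> a file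
  consists of \<open>T\<close> segments from the field \<open>\<FF>\<close>. An outcome \<open>w\<close> of the product measure below is the
  tuple of all files, so the files \<open>\<lambda>w. w n\<close> are independent and uniformly distributed on \<open>A\<close>.
\<close>

definition file_bits :: "'w set \<Rightarrow> real" where
  "file_bits A = log 2 (real (card A))"

definition file_space :: "nat \<Rightarrow> 'w set \<Rightarrow> (nat \<Rightarrow> 'w) measure" where
  "file_space N A = Pi\<^sub>M {1..N} (\<lambda>_. uniform_count_measure A)"

text \<open>The set \<open>[2\<^sup>b]\<close>, for a number of bits \<open>b\<close> that need not be an integer.\<close>

definition bit_range :: "real \<Rightarrow> nat set" where
  "bit_range b = {1..nat \<lfloor>2 powr b\<rfloor>}"

definition uniform_demands :: "nat \<Rightarrow> nat \<Rightarrow> (nat \<Rightarrow> nat) set" where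
  "uniform_demands N K =
     {d \<in> {1..K * N} \<rightarrow>\<^sub>E {1..N}. \<forall>n\<in>{1..N}. card {k \<in> {1..K * N}. d k = n} = K}"

text \<open>Shannon conditional entropy \<open>H(U | V)\<close> in bits of discrete random variables on \<open>P\<close>;
  \<^const>\<open>prob_space.conditional_entropy\<close> is instantiated as in the library's notation \<open>\<H>(U | V)\<close>.\<close>

definition cond_entropy :: "'s measure \<Rightarrow> ('s \<Rightarrow> 'u) \<Rightarrow> ('s \<Rightarrow> 'v) \<Rightarrow> real" where
  "cond_entropy P U V =
     prob_space.conditional_entropy P 2
       (count_space (U ` space P)) (count_space (V ` space P)) U V"

text \<open>
  \<open>Z k w\<close> is the content of the cache of user \<open>k\<close> and \<open>X d w\<close> the message broadcast for the demand
  vector \<open>d\<close>, when the files are \<open>w\<close>. The placement \<open>Z\<close> does not depend on \<open>d\<close>. At least two file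
  values are required, since otherwise files have zero bits and every rate is trivially attained.
\<close>

definition caching_scheme ::
  "nat \<Rightarrow> nat \<Rightarrow> 'w set \<Rightarrow> real \<Rightarrow> real \<Rightarrow> (nat \<Rightarrow> (nat \<Rightarrow> 'w) \<Rightarrow> nat) \<Rightarrow>
     ((nat \<Rightarrow> nat) \<Rightarrow> (nat \<Rightarrow> 'w) \<Rightarrow> nat) \<Rightarrow> bool" where
  "caching_scheme N K A M R Z X \<longleftrightarrow>
     finite A \<and> 2 \<le> card A \<and> 0 \<le> M \<and> M \<le> real N \<and>
     (\<forall>k\<in>{1..K * N}. Z k \<in> space (file_space N A) \<rightarrow> bit_range (M * file_bits A)) \<and>
     (\<forall>d\<in>uniform_demands N K.
        X d \<in> space (file_space N A) \<rightarrow> bit_range (R * file_bits A) \<and>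
        (\<forall>k\<in>{1..K * N}.
           cond_entropy (file_space N A) (\<lambda>w. w (d k)) (\<lambda>w. (Z k w, d k, X d w)) = 0))"

definition achievable_over :: "('a, 'b) ring_scheme \<Rightarrow> nat \<Rightarrow> nat \<Rightarrow> real \<Rightarrow> real \<Rightarrow> bool" where
  "achievable_over \<FF> N K M R \<longleftrightarrow>
     (\<exists>T::nat. T \<ge> 1 \<and> (\<exists>Z X. caching_scheme N K ({1..T} \<rightarrow>\<^sub>E carrier \<FF>) M R Z X))"

text \<open>
  The slack \<open>\<epsilon>\<close> in the rate is needed for irrational \<open>M\<close>: the \<open>N\<close> caches of users with distinct
  demands and the message determine all \<open>N\<close> files, so rate exactly \<open>N * (1 - M)\<close> would force
  \<open>2 powr (M * F)\<close> to be a power of two. The cache memory is not relaxed.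
\<close>

definition achievable :: "nat \<Rightarrow> nat \<Rightarrow> real \<Rightarrow> real \<Rightarrow> bool" where
  "achievable N K M R \<longleftrightarrow>
     (\<forall>\<epsilon>>0. \<exists>F\<ge>1. \<exists>Z X. caching_scheme N K {1..(2::nat) ^ F} M (R + \<epsilon>) Z X)"

end

theory Submission
  imports Defs "HOL-Number_Theory.Residues"
begin

text \<open>
  Put \<open>D = K * (N - 1)\<close> and give the users distinct field elements \<open>x k\<close>. A file is a polynomial of degree
  at most \<open>D\<close>, and user \<open>k\<close> caches the single symbol \<open>\<Sum>n. W n (x k)\<close>. For a demand vector with uniform
  profile exactly \<open>D\<close> users do not want file \<open>n\<close>, so there is a monic polynomial \<open>a n\<close> of degree \<open>D\<close> whose
  roots among the \<open>x k\<close> are exactly their points. The server sends \<open>W n\<close> modulo \<open>a n\<close>, which is \<open>D\<close> symbols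
  per file; only the leading coefficients are missing. At \<open>x k\<close> every \<open>a n\<close> with \<open>n \<noteq> d k\<close>
  vanishes, so the cached symbol yields the leading coefficient of \<open>W (d k)\<close>. Smaller caches are
  handled by coding only part of each file in this way and sending the rest uncoded.
\<close>

section \<open>Decodability as vanishing conditional entropy\<close>

text \<open>Determinism makes the fibre of the pair over \<open>(X w, Y w)\<close> equal to the
  fibre of \<open>Y\<close> over \<open>Y w\<close>, so each summand is p * log (p / p), which
  vanishes, also for p = 0.\<close>

lemma (in information_space) conditional_entropy_determined:
  assumes X: "simple_function M X" and Y: "simple_function M Y"
    and det: "\<And>v w. v \<in> space M \<Longrightarrow> w \<in> space M \<Longrightarrow> Y v = Y w \<Longrightarrow> X v = X w"
  shows "\<H>(X | Y) = 0"
proof -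
  let ?XY = "\<lambda>w. (X w, Y w)"
  have Py: "simple_distributed M Y (\<lambda>y. measure M (Y -` {y} \<inter> space M))"
    using Y by (rule simple_distributedI) auto
  have Pxy: "simple_distributed M ?XY (\<lambda>z. measure M (?XY -` {z} \<inter> space M))"
    using simple_function_Pair[OF X Y] by (rule simple_distributedI) auto
  have eq: "?XY -` {(X w, Y w)} \<inter> space M = Y -` {Y w} \<inter> space M" if "w \<in> space M" for w
    using det[OF _ that] by blast
  have "measure M (?XY -` {(X w, Y w)} \<inter> space M) *
      log b (measure M (?XY -` {(X w, Y w)} \<inter> space M) / measure M (Y -` {Y w} \<inter> space M)) = 0"
    if "w \<in> space M" for w
    unfolding eq[OF that] by (cases "measure M (Y -` {Y w} \<inter> space M) = 0") simp_all
  then show ?thesis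
    by (subst conditional_entropy_eq[OF Py Pxy]) (auto intro!: sum.neutral simp del: vimage_eq)
qed

lemma space_file_space: "space (file_space N A) = {1..N} \<rightarrow>\<^sub>E A"
  by (simp add: file_space_def space_PiM space_uniform_count_measure)

text \<open>Singletons are boxes with finitely many factors, and every set of outcomes is a finite
  union of them. All functions of the files are therefore simple, so placements and messages raise
  no measurability questions.\<close>

lemma sets_file_space:
  assumes "finite A"
  shows "sets (file_space N A) = Pow ({1..N} \<rightarrow>\<^sub>E A)"
proof
  show "sets (file_space N A) \<subseteq> Pow ({1..N} \<rightarrow>\<^sub>E A)"
    using sets.sets_into_space[of _ "file_space N A"] by (auto simp: space_file_space)
  show "Pow ({1..N} \<rightarrow>\<^sub>E A) \<subseteq> sets (file_space N A)"
  proof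
    fix S assume "S \<in> Pow ({1..N} \<rightarrow>\<^sub>E A)"
    moreover have "{w} \<in> sets (file_space N A)" if "w \<in> {1..N} \<rightarrow>\<^sub>E A" for w
    proof -
      have "(\<Pi>\<^sub>E n\<in>{1..N}. {w n}) \<in> sets (file_space N A)"
        unfolding file_space_def using that
        by (intro sets_PiM_I_finite) (auto simp: sets_uniform_count_measure)
      then show ?thesis
        using that PiE_singleton[of w "{1..N}"] by (auto simp: PiE_def)
    qed
    moreover have "finite S"
      using calculation(1) assms by (meson PowD finite_PiE finite_atLeastAtMost finite_subset)
    ultimately have "(\<Union>w\<in>S. {w}) \<in> sets (file_space N A)"
      by (intro sets.finite_UN) auto
    then show "S \<in> sets (file_space N A)" by simp
  qed
qed

lemma simple_function_file_space:
  assumes "finite A"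
  shows "simple_function (file_space N A) f"
  using assms by (auto simp: simple_function_def sets_file_space space_file_space finite_PiE)

lemma cond_entropy_file_space_eq_0:
  assumes "finite A" "A \<noteq> {}"
    and "\<And>v w. v \<in> {1..N} \<rightarrow>\<^sub>E A \<Longrightarrow> w \<in> {1..N} \<rightarrow>\<^sub>E A \<Longrightarrow> g v = g w \<Longrightarrow> f v = f w"
  shows "cond_entropy (file_space N A) f g = 0"
proof -
  interpret prob_space "file_space N A"
    unfolding file_space_def
    by (intro prob_space_PiM prob_space_uniform_count_measure assms)
  interpret information_space "file_space N A" 2
    by standard simp
  show ?thesis
    unfolding cond_entropy_def
    by (intro conditional_entropy_determined simple_function_file_space assms(1))
       (unfold space_file_space, rule assms(3))
qed

lemma card_le_bit_range:
  "real n \<le> 2 powr b \<Longrightarrow> n \<le> card (bit_range b)"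
  by (simp add: bit_range_def le_nat_floor)

lemma inj_into_bit_range:
  assumes "finite C" "real (card C) \<le> 2 powr b"
  obtains e where "inj_on e C" "e \<in> C \<rightarrow> bit_range b"
proof -
  have "finite (bit_range b)" by (simp add: bit_range_def)
  from card_le_inj[OF assms(1) this card_le_bit_range[OF assms(2)]] show ?thesis
    using that by blast
qed

text \<open>Reduces the construction to combinatorics: caches and messages may live in any finite
  alphabets of the right size, and decodability becomes a statement about two file tuples with equal
  observations. The injective relabelling into \<open>bit_range\<close> loses nothing.\<close>

lemma caching_schemeI:
  fixes Z :: "nat \<Rightarrow> (nat \<Rightarrow> 'w) \<Rightarrow> 'c" and X :: "(nat \<Rightarrow> nat) \<Rightarrow> (nat \<Rightarrow> 'w) \<Rightarrow> 'd"
  assumes A: "finite A" "2 \<le> card A" and M: "0 \<le> M" "M \<le> real N"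
    and C: "finite C" "real (card C) \<le> 2 powr (M * file_bits A)"
    and D: "finite D" "real (card D) \<le> 2 powr (R * file_bits A)"
    and Z: "\<And>k w. k \<in> {1..K * N} \<Longrightarrow> w \<in> {1..N} \<rightarrow>\<^sub>E A \<Longrightarrow> Z k w \<in> C"
    and X: "\<And>d w. d \<in> uniform_demands N K \<Longrightarrow> w \<in> {1..N} \<rightarrow>\<^sub>E A \<Longrightarrow> X d w \<in> D"
    and decode: "\<And>d k v w. d \<in> uniform_demands N K \<Longrightarrow> k \<in> {1..K * N} \<Longrightarrow>
       v \<in> {1..N} \<rightarrow>\<^sub>E A \<Longrightarrow> w \<in> {1..N} \<rightarrow>\<^sub>E A \<Longrightarrow> Z k v = Z k w \<Longrightarrow> X d v = X d w \<Longrightarrow>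
       v (d k) = w (d k)"
  shows "\<exists>Z X. caching_scheme N K A M R Z X"
proof -
  obtain e where e: "inj_on e C" "e \<in> C \<rightarrow> bit_range (M * file_bits A)"
    using inj_into_bit_range[OF C] .
  obtain h where h: "inj_on h D" "h \<in> D \<rightarrow> bit_range (R * file_bits A)"
    using inj_into_bit_range[OF D] .
  have "A \<noteq> {}" using A by auto
  have "caching_scheme N K A M R (\<lambda>k w. e (Z k w)) (\<lambda>d w. h (X d w))"
    unfolding caching_scheme_def space_file_space
  proof (intro conjI ballI A M)
    show "(\<lambda>w. e (Z k w)) \<in> ({1..N} \<rightarrow>\<^sub>E A) \<rightarrow> bit_range (M * file_bits A)"
      if "k \<in> {1..K * N}" for k
      using e Z that by blast
  next
    fix d assume d: "d \<in> uniform_demands N K"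
    show "(\<lambda>w. h (X d w)) \<in> ({1..N} \<rightarrow>\<^sub>E A) \<rightarrow> bit_range (R * file_bits A)"
      using h X d by blast
    fix k assume k: "k \<in> {1..K * N}"
    show "cond_entropy (file_space N A) (\<lambda>w. w (d k)) (\<lambda>w. (e (Z k w), d k, h (X d w))) = 0"
    proof (intro cond_entropy_file_space_eq_0 A \<open>A \<noteq> {}\<close>)
      fix v w assume vw: "v \<in> {1..N} \<rightarrow>\<^sub>E A" "w \<in> {1..N} \<rightarrow>\<^sub>E A"
        and "(e (Z k v), d k, h (X d v)) = (e (Z k w), d k, h (X d w))"
      then have "Z k v = Z k w" "X d v = X d w"
        using e(1) h(1) Z X d k by (auto dest: inj_onD)
      then show "v (d k) = w (d k)"
        using decode d k vw by blast
    qed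
  qed
  then show ?thesis by blast
qed

section \<open>Polynomials as coefficient functions, and decoding of one block\<close>

text \<open>\<open>D\<close> is only a formal degree bound: a block of file symbols serves directly
  as a polynomial, and its top coefficient may be zero.\<close>

definition (in ring) peval :: "nat \<Rightarrow> (nat \<Rightarrow> 'a) \<Rightarrow> 'a \<Rightarrow> 'a" where
  "peval D a x = (\<Oplus>i\<in>{..D}. a i \<otimes> x [^] i)"

lemma (in ring) peval_closed [simp]:
  assumes "a \<in> {..D} \<rightarrow> carrier R" "x \<in> carrier R"
  shows "peval D a x \<in> carrier R"
  using assms by (auto simp: peval_def intro!: finsum_closed)

lemma (in ring) peval_cong:
  assumes "\<And>i. i \<le> D \<Longrightarrow> a i = b i" "b \<in> {..D} \<rightarrow> carrier R" "x \<in> carrier R"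
  shows "peval D a x = peval D b x"
  unfolding peval_def using assms by (intro finsum_cong') auto

lemma (in cring) peval_add_smult:
  assumes "a \<in> {..D} \<rightarrow> carrier R" "b \<in> {..D} \<rightarrow> carrier R" "c \<in> carrier R" "x \<in> carrier R"
  shows "peval D (\<lambda>i. a i \<oplus> c \<otimes> b i) x = peval D a x \<oplus> c \<otimes> peval D b x"
proof -
  have ab: "\<And>i. i \<le> D \<Longrightarrow> a i \<in> carrier R" "\<And>i. i \<le> D \<Longrightarrow> b i \<in> carrier R"
    using assms by auto
  have "peval D (\<lambda>i. a i \<oplus> c \<otimes> b i) x = (\<Oplus>i\<in>{..D}. a i \<otimes> x [^] i \<oplus> c \<otimes> (b i \<otimes> x [^] i))"
    unfolding peval_def using ab assms(3,4) by (intro finsum_cong') (auto simp: l_distr m_assoc)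
  also have "\<dots> = peval D a x \<oplus> (\<Oplus>i\<in>{..D}. c \<otimes> (b i \<otimes> x [^] i))"
    unfolding peval_def using ab assms(3,4) by (intro finsum_addf) auto
  also have "(\<Oplus>i\<in>{..D}. c \<otimes> (b i \<otimes> x [^] i)) = c \<otimes> peval D b x"
    unfolding peval_def using ab assms(3,4) by (intro finsum_rdistr[symmetric]) auto
  finally show ?thesis .
qed

text \<open>This is the product of the factors X - y over \<open>Y\<close>, built one root at a
  time; without zero divisors it has no further roots.\<close>

lemma (in domain) monic_with_roots:
  assumes "finite Y" "Y \<subseteq> carrier R"
  shows "\<exists>a. a \<in> UNIV \<rightarrow> carrier R \<and> (\<forall>i>card Y. a i = \<zero>) \<and> a (card Y) = \<one> \<and>
           (\<forall>x\<in>carrier R. peval (card Y) a x = \<zero> \<longleftrightarrow> x \<in> Y)"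
  using assms
proof (induction rule: finite_induct)
  case empty
  show ?case
    by (rule exI[of _ "\<lambda>i. if i = 0 then \<one> else \<zero>"]) (auto simp: peval_def)
next
  case (insert y Y)
  let ?D = "card Y"
  obtain a where "a \<in> UNIV \<rightarrow> carrier R" "\<forall>i>?D. a i = \<zero>" "a ?D = \<one>"
      "\<forall>x\<in>carrier R. peval ?D a x = \<zero> \<longleftrightarrow> x \<in> Y"
    using insert.IH insert.prems by blast
  then have a: "\<And>i. a i \<in> carrier R" "\<And>i. i > ?D \<Longrightarrow> a i = \<zero>" "a ?D = \<one>"
      "\<And>x. x \<in> carrier R \<Longrightarrow> peval ?D a x = \<zero> \<longleftrightarrow> x \<in> Y"
    by auto
  have y: "y \<in> carrier R" using insert by auto
  \<comment> \<open>Shifting the coefficients by one multiplies by the variable, so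
    \<open>a'\<close> below is the polynomial (X - y) * a.\<close>
  define s where "s = case_nat \<zero> a"
  have s: "s i \<in> carrier R" for i using a by (auto simp: s_def split: nat.split)
  define a' where "a' i = s i \<oplus> (\<ominus> y) \<otimes> a i" for i
  have "peval (Suc ?D) a' x = \<zero> \<longleftrightarrow> x \<in> insert y Y" if x: "x \<in> carrier R" for x
  proof -
    have "peval (Suc ?D) s x = (\<Oplus>i\<in>{..?D}. a i \<otimes> x [^] Suc i)"
      unfolding peval_def using a s x
      by (subst finsum_Suc2) (auto simp: s_def intro!: finsum_closed)
    also have "\<dots> = (\<Oplus>i\<in>{..?D}. x \<otimes> (a i \<otimes> x [^] i))"
      using a x by (intro finsum_cong') (auto simp: m_ac)
    also have "\<dots> = x \<otimes> peval ?D a x"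
      unfolding peval_def using a x by (intro finsum_rdistr[symmetric]) auto
    finally have 1: "peval (Suc ?D) s x = x \<otimes> peval ?D a x" .
    \<comment> \<open>The coefficient of \<open>a\<close> at \<open>Suc ?D\<close> is zero, so
      raising the degree bound keeps the value; hence the induction carries the vanishing of higher
      coefficients.\<close>
    have 2: "peval (Suc ?D) a x = peval ?D a x"
      unfolding peval_def using a x by (subst finsum_Suc) (auto intro!: finsum_closed)
    have pc: "peval ?D a x \<in> carrier R" using a x by auto
    have "peval (Suc ?D) a' x = peval (Suc ?D) s x \<oplus> (\<ominus> y) \<otimes> peval (Suc ?D) a x"
      unfolding a'_def using a s x y by (intro peval_add_smult) auto
    also have "\<dots> = (x \<ominus> y) \<otimes> peval ?D a x"
      using x y pc by (simp add: 1 2 l_distr minus_eq)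
    finally have eq: "peval (Suc ?D) a' x = (x \<ominus> y) \<otimes> peval ?D a x" .
    show ?thesis
      unfolding eq using x y pc a(4)[OF x] by (auto simp: integral_iff)
  qed
  moreover have "a' (Suc ?D) = \<one>" "\<forall>i>Suc ?D. a' i = \<zero>"
    using a y by (auto simp: a'_def s_def split: nat.split)
  moreover have "a' \<in> UNIV \<rightarrow> carrier R"
    using a s y by (auto simp: a'_def)
  ultimately show ?case
    using insert by (intro exI[of _ a']) auto
qed

text \<open>Writing each \<open>u n\<close> as a message part plus its top coefficient times \<open>a n\<close>, the cached
  evaluation at a common root of all \<open>a n\<close> with \<open>n \<noteq> m\<close> reveals the top coefficient of \<open>u m\<close>.\<close>

lemma (in domain) decode_block:
  assumes S: "finite S" "m \<in> S" and x: "x \<in> carrier R"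
    and a: "\<And>n i. n \<in> S \<Longrightarrow> i \<le> D \<Longrightarrow> a n i \<in> carrier R" "\<And>n. n \<in> S \<Longrightarrow> a n D = \<one>"
    and root: "\<And>n. n \<in> S \<Longrightarrow> peval D (a n) x = \<zero> \<longleftrightarrow> n \<noteq> m"
    and u: "\<And>n i. n \<in> S \<Longrightarrow> i \<le> D \<Longrightarrow> u n i \<in> carrier R"
    and v: "\<And>n i. n \<in> S \<Longrightarrow> i \<le> D \<Longrightarrow> v n i \<in> carrier R"
    and msg: "\<And>n i. n \<in> S \<Longrightarrow> i < D \<Longrightarrow> u n i \<ominus> u n D \<otimes> a n i = v n i \<ominus> v n D \<otimes> a n i"
    and cache: "(\<Oplus>n\<in>S. peval D (u n) x) = (\<Oplus>n\<in>S. peval D (v n) x)"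
    and i: "i \<le> D"
  shows "u m i = v m i"
proof -
  \<comment> \<open>The remainder of \<open>u n\<close> modulo the monic \<open>a n\<close>, which
    is the part given by the message.\<close>
  define r where "r n i = u n i \<ominus> u n D \<otimes> a n i" for n i
  have r: "r n i \<in> carrier R" if "n \<in> S" "i \<le> D" for n i
    using a u that by (auto simp: r_def)
  \<comment> \<open>At index \<open>D\<close>, about which the message says nothing, both sides
    vanish because \<open>a n D\<close> is one.\<close>
  have r_v: "r n i = v n i \<ominus> v n D \<otimes> a n i" if "n \<in> S" "i \<le> D" for n i
    using that msg[of n i] u[of n D] v[of n D] a(2)[of n]
    by (cases "i = D") (auto simp: r_def minus_eq r_neg)
  have split: "z n i = r n i \<oplus> z n D \<otimes> a n i"
    if "n \<in> S" "i \<le> D" "\<And>n i. n \<in> S \<Longrightarrow> i \<le> D \<Longrightarrow> z n i \<in> carrier R"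
       "r n i = z n i \<ominus> z n D \<otimes> a n i" for z n i
    using that a(1)[of n i] by (simp add: minus_eq a_assoc l_neg)
  define s where "s = (\<Oplus>n\<in>S. peval D (r n) x)"
  have s: "s \<in> carrier R"
    unfolding s_def using r x by (auto intro!: finsum_closed)
  have pa: "peval D (a n) x \<in> carrier R" if "n \<in> S" for n
    using that a x by auto
  have root0: "peval D (a n) x = \<zero>" if "n \<in> S" "n \<noteq> m" for n
    using root that by blast
  \<comment> \<open>Stated for a generic \<open>z\<close> because it is applied to \<open>u\<close>
    and to \<open>v\<close>, which share the remainders \<open>r\<close> and hence
    \<open>s\<close>.\<close>
  have sum: "(\<Oplus>n\<in>S. peval D (z n) x) = s \<oplus> z m D \<otimes> peval D (a m) x"
    if z: "\<And>n i. n \<in> S \<Longrightarrow> i \<le> D \<Longrightarrow> z n i \<in> carrier R"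
      and rz: "\<And>n i. n \<in> S \<Longrightarrow> i \<le> D \<Longrightarrow> r n i = z n i \<ominus> z n D \<otimes> a n i" for z
  proof -
    have "(\<Oplus>n\<in>S. peval D (z n) x) = (\<Oplus>n\<in>S. peval D (r n) x \<oplus> z n D \<otimes> peval D (a n) x)"
    proof (intro finsum_cong' refl)
      fix n assume n: "n \<in> S"
      have "peval D (z n) x = peval D (\<lambda>i. r n i \<oplus> z n D \<otimes> a n i) x"
        using n x r z a by (intro peval_cong split z rz) auto
      also have "\<dots> = peval D (r n) x \<oplus> z n D \<otimes> peval D (a n) x"
        using n x r z a by (intro peval_add_smult) auto
      finally show "peval D (z n) x = peval D (r n) x \<oplus> z n D \<otimes> peval D (a n) x" .
    qed (use r x z pa in auto)
    also have "\<dots> = s \<oplus> (\<Oplus>n\<in>S. z n D \<otimes> peval D (a n) x)"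
      unfolding s_def using r x z pa by (intro finsum_addf) auto
    \<comment> \<open>The point \<open>x\<close> is a root of every \<open>a n\<close> except
      \<open>a m\<close>, so only the term of file \<open>m\<close> survives.\<close>
    also have "(\<Oplus>n\<in>S. z n D \<otimes> peval D (a n) x)
        = (\<Oplus>n\<in>S. if m = n then z n D \<otimes> peval D (a n) x else \<zero>)"
      using z pa root0 by (intro finsum_cong') auto
    also have "\<dots> = z m D \<otimes> peval D (a m) x"
      using S z pa by (intro finsum_singleton) auto
    finally show ?thesis .
  qed
  have "s \<oplus> u m D \<otimes> peval D (a m) x = s \<oplus> v m D \<otimes> peval D (a m) x"
    using cache sum[of u, OF u r_def] sum[of v, OF v r_v] by simp
  then have "u m D \<otimes> peval D (a m) x = v m D \<otimes> peval D (a m) x"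
    using s pa u v S by simp
  \<comment> \<open>Since \<open>x\<close> is not a root of \<open>a m\<close>, the common factor
    cancels.\<close>
  then have "u m D = v m D"
    using root[OF S(2)] pa[OF S(2)] u v S by (simp add: m_rcancel)
  then show ?thesis
    using split[of m i u, OF S(2) i u r_def] split[of m i v, OF S(2) i v r_v[OF S(2) i]] by simp
qed


section \<open>The coded scheme for uniform demands\<close>

text \<open>The uniform profile enters here: the count is the same for all files and demand vectors,
  so the block length can be fixed before the demands are known.\<close>

lemma uniform_demands_card_other:
  assumes "d \<in> uniform_demands N K" "n \<in> {1..N}"
  shows "card {k \<in> {1..K * N}. d k \<noteq> n} = K * (N - 1)"
proof -
  have eq: "{k \<in> {1..K * N}. d k \<noteq> n} = {1..K * N} - {k \<in> {1..K * N}. d k = n}"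
    by auto
  have "card {k \<in> {1..K * N}. d k = n} = K"
    using assms unfolding uniform_demands_def by blast
  moreover have "card ({1..K * N} - {k \<in> {1..K * N}. d k = n}) =
      card {1..K * N} - card {k \<in> {1..K * N}. d k = n}"
    by (rule card_Diff_subset) auto
  ultimately show ?thesis
    unfolding eq by (simp only: card_atLeastAtMost diff_mult_distrib2)
qed

text \<open>The roots are placed at the points of the users not demanding \<open>n\<close>. As
  \<open>x\<close> is injective, no user demanding \<open>n\<close> sits on a root.\<close>

lemma (in field) demand_polynomials:
  assumes x: "inj_on x {1..K * N}" "x \<in> {1..K * N} \<rightarrow> carrier R"
    and d: "d \<in> uniform_demands N K" "n \<in> {1..N}"
  shows "\<exists>a. a \<in> UNIV \<rightarrow> carrier R \<and> a (K * (N - 1)) = \<one> \<and>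
           (\<forall>k\<in>{1..K * N}. peval (K * (N - 1)) a (x k) = \<zero> \<longleftrightarrow> d k \<noteq> n)"
proof -
  let ?Y = "x ` {k \<in> {1..K * N}. d k \<noteq> n}"
  have card: "card ?Y = K * (N - 1)"
    unfolding uniform_demands_card_other[OF d, symmetric]
    by (rule card_image, rule inj_on_subset[OF x(1)]) auto
  have "finite ?Y" "?Y \<subseteq> carrier R" using x by auto
  from monic_with_roots[OF this] obtain a where
    a: "a \<in> UNIV \<rightarrow> carrier R" "a (K * (N - 1)) = \<one>"
       "\<forall>y\<in>carrier R. peval (K * (N - 1)) a y = \<zero> \<longleftrightarrow> y \<in> ?Y"
    unfolding card by blast
  have "peval (K * (N - 1)) a (x k) = \<zero> \<longleftrightarrow> d k \<noteq> n" if k: "k \<in> {1..K * N}" for k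
  proof -
    have "x k \<in> carrier R" using x(2) k by (rule funcset_mem)
    then have "peval (K * (N - 1)) a (x k) = \<zero> \<longleftrightarrow> x k \<in> ?Y"
      using a(3) by (rule bspec[rotated])
    also have "\<dots> \<longleftrightarrow> k \<in> {k \<in> {1..K * N}. d k \<noteq> n}"
      by (rule inj_on_image_mem_iff[OF x(1) k]) blast
    also have "\<dots> \<longleftrightarrow> d k \<noteq> n" using k by simp
    finally show ?thesis .
  qed
  then show ?thesis by (intro exI[of _ a] conjI ballI a(1,2))
qed

text \<open>A file becomes \<open>T\<close> field symbols, of which \<open>t\<close> blocks of
  length \<open>K * (N - 1) + 1\<close> are coded. A user caches one symbol per block, and the
  message saves one symbol per block and file. Since \<open>A\<close> is merely embedded into the
  strings, bit files are covered too.\<close>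

lemma (in field) coded_caching_scheme:
  fixes A :: "'w set"
  assumes q: "finite (carrier R)" "K * N \<le> card (carrier R)"
    and A: "finite A" "2 \<le> card A" "card A \<le> card (carrier R) ^ T"
    and t: "t * (K * (N - 1) + 1) \<le> T"
    and M: "0 \<le> M" "M \<le> real N" "real (card (carrier R) ^ t) \<le> 2 powr (M * file_bits A)"
    and rate: "real (card (carrier R) ^ (N * (T - t))) \<le> 2 powr (r * file_bits A)"
  shows "\<exists>Z X. caching_scheme N K A M r Z X"
proof -
  define D where "D = K * (N - 1)"
  define P where "P = Suc D"
  have P: "0 < P" "D < P" by (auto simp: P_def)
  have tP: "t * P \<le> T" using t by (simp add: P_def D_def)
  obtain x where x: "inj_on x {1..K * N}" "x \<in> {1..K * N} \<rightarrow> carrier R"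
    using card_le_inj[of "{1..K * N}" "carrier R"] q by auto
  have "finite ({..<T} \<rightarrow>\<^sub>E carrier R)" "card A \<le> card ({..<T} \<rightarrow>\<^sub>E carrier R)"
    using q A by (auto simp: card_PiE finite_PiE)
  from card_le_inj[OF A(1) this] obtain enc where
    enc: "inj_on enc A" "enc ` A \<subseteq> {..<T} \<rightarrow>\<^sub>E carrier R" by blast
  \<comment> \<open>The polynomials depend on \<open>d\<close>, but only the message uses them; the
    placement needs just the points \<open>x\<close>.\<close>
  define a where "a d n = (SOME a. a \<in> UNIV \<rightarrow> carrier R \<and> a D = \<one> \<and>
      (\<forall>k\<in>{1..K * N}. peval D a (x k) = \<zero> \<longleftrightarrow> d k \<noteq> n))" for d :: "nat \<Rightarrow> nat" and n
  have "a d n \<in> UNIV \<rightarrow> carrier R \<and> a d n D = \<one> \<and>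
      (\<forall>k\<in>{1..K * N}. peval D (a d n) (x k) = \<zero> \<longleftrightarrow> d k \<noteq> n)"
    if "d \<in> uniform_demands N K" "n \<in> {1..N}" for d n
    unfolding a_def D_def by (rule someI_ex[OF demand_polynomials[OF x that]])
  then have a: "\<And>d n i. d \<in> uniform_demands N K \<Longrightarrow> n \<in> {1..N} \<Longrightarrow> a d n i \<in> carrier R"
      "\<And>d n. d \<in> uniform_demands N K \<Longrightarrow> n \<in> {1..N} \<Longrightarrow> a d n D = \<one>"
      "\<And>d n k. d \<in> uniform_demands N K \<Longrightarrow> n \<in> {1..N} \<Longrightarrow> k \<in> {1..K * N} \<Longrightarrow>
         peval D (a d n) (x k) = \<zero> \<longleftrightarrow> d k \<noteq> n"
    by blast+
  \<comment> \<open>\<open>tops\<close> holds the positions of the top coefficients, the last symbol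
    of each block; \<open>J\<close> holds the positions that are transmitted.\<close>
  define tops where "tops = (\<lambda>j. j * P + D) ` {..<t}"
  define J where "J = {..<T} - tops"
  have block: "j * P + i < t * P" if "j < t" "i < P" for i j
  proof -
    have "j * P + i < Suc j * P" using that by simp
    also have "\<dots> \<le> t * P" using that by (intro mult_le_mono1) simp
    finally show ?thesis .
  qed
  have idx: "j * P + i < T" if "j < t" "i < P" for i j
    using block[OF that] tP by linarith
  have card_J: "card J = T - t"
  proof -
    have "inj_on (\<lambda>j. j * P + D) {..<t}" using P by (auto simp: inj_on_def)
    then have "card tops = t" by (simp add: tops_def card_image)
    moreover have "tops \<subseteq> {..<T}" using idx P by (auto simp: tops_def)
    ultimately show ?thesis by (simp add: J_def card_Diff_subset finite_subset)
  qed
  have fin_NJ: "finite ({1..N} \<times> J)" by (simp add: J_def)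
  define Z where "Z k w = (\<lambda>j\<in>{..<t}. \<Oplus>n\<in>{1..N}. peval D (\<lambda>i. enc (w n) (j * P + i)) (x k))"
    for k and w :: "nat \<Rightarrow> 'w"
  \<comment> \<open>For \<open>s\<close> in the coded region, \<open>s div P\<close> is the block,
    \<open>s mod P\<close> the coefficient index and \<open>s div P * P + D\<close> the position of
    the top coefficient.\<close>
  define X where "X d w = (\<lambda>(n, s)\<in>{1..N} \<times> J.
      if s < t * P then enc (w n) s \<ominus> enc (w n) (s div P * P + D) \<otimes> a d n (s mod P)
      else enc (w n) s)" for d and w :: "nat \<Rightarrow> 'w"
  have enc_w: "enc (w n) s \<in> carrier R"
    if "w \<in> {1..N} \<rightarrow>\<^sub>E A" "n \<in> {1..N}" "s < T" for w n s
  proof -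
    have "w n \<in> A" using that(1,2) by (rule PiE_mem)
    then have "enc (w n) \<in> {..<T} \<rightarrow>\<^sub>E carrier R" using enc(2) by blast
    then show ?thesis using that(3) by auto
  qed
  have top_lt: "s div P * P + D < T" if "s < t * P" for s
    using that P by (intro idx) (auto simp: less_mult_imp_div_less)
  show ?thesis
  proof (rule caching_schemeI[where C = "{..<t} \<rightarrow>\<^sub>E carrier R"
        and D = "({1..N} \<times> J) \<rightarrow>\<^sub>E carrier R" and Z = Z and X = X])
    show "finite ({..<t} \<rightarrow>\<^sub>E carrier R)" "finite (({1..N} \<times> J) \<rightarrow>\<^sub>E carrier R)"
      using q by (auto intro!: finite_PiE simp: J_def)
    show "real (card ({..<t} \<rightarrow>\<^sub>E carrier R)) \<le> 2 powr (M * file_bits A)"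
      using M(3) by (simp add: card_PiE)
    show "real (card (({1..N} \<times> J) \<rightarrow>\<^sub>E carrier R)) \<le> 2 powr (r * file_bits A)"
      using rate card_PiE[OF fin_NJ, of "\<lambda>_. carrier R"]
      by (simp add: card_J card_cartesian_product)
  next
    fix k w assume "k \<in> {1..K * N}" "w \<in> {1..N} \<rightarrow>\<^sub>E A"
    then show "Z k w \<in> {..<t} \<rightarrow>\<^sub>E carrier R"
      unfolding Z_def using x idx P_def
      by (auto intro!: finsum_closed peval_closed enc_w)
  next
    fix d w assume "d \<in> uniform_demands N K" "w \<in> {1..N} \<rightarrow>\<^sub>E A"
    then have "enc (w n) s \<in> carrier R" "a d n i \<in> carrier R" if "n \<in> {1..N}" "s < T" for n s i
      using that enc_w a(1) by blast+
    then show "X d w \<in> ({1..N} \<times> J) \<rightarrow>\<^sub>E carrier R"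
      unfolding X_def using top_lt by (auto simp: J_def)
  next
    fix d k v w
    assume d: "d \<in> uniform_demands N K" and k: "k \<in> {1..K * N}"
      and v: "v \<in> {1..N} \<rightarrow>\<^sub>E A" and w: "w \<in> {1..N} \<rightarrow>\<^sub>E A"
      and Zeq: "Z k v = Z k w" and Xeq: "X d v = X d w"
    have m: "d k \<in> {1..N}"
      using d by (intro PiE_mem[OF _ k, of d "\<lambda>_. {1..N}"]) (simp add: uniform_demands_def)
    have "enc (v (d k)) s = enc (w (d k)) s" if s: "s < T" for s
    proof (cases "s < t * P")
      case False
      \<comment> \<open>Beyond the coded region no position is omitted, so the symbol is read off
        the message.\<close>
      have "s \<notin> tops" using False block P by (auto simp: tops_def)
      then have "s \<in> J" using s by (simp add: J_def)
      then show ?thesis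
        using fun_cong[OF Xeq, of "(d k, s)"] m False by (simp add: X_def)
    next
      case True
      define j where "j = s div P"
      have j: "j < t" using True by (simp add: j_def less_mult_imp_div_less)
      have "enc (v (d k)) (j * P + s mod P) = enc (w (d k)) (j * P + s mod P)"
      proof (rule decode_block[where S = "{1..N}" and m = "d k" and D = D and x = "x k"
            and a = "a d" and i = "s mod P"
            and u = "\<lambda>n i. enc (v n) (j * P + i)" and v = "\<lambda>n i. enc (w n) (j * P + i)"])
        show "(\<Oplus>n\<in>{1..N}. peval D (\<lambda>i. enc (v n) (j * P + i)) (x k)) =
              (\<Oplus>n\<in>{1..N}. peval D (\<lambda>i. enc (w n) (j * P + i)) (x k))"
          using fun_cong[OF Zeq, of j] j by (simp add: Z_def)
        show "s mod P \<le> D" using P_def by (simp add: less_Suc_eq_le[symmetric])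
        fix n i assume n: "n \<in> {1..N}" and i: "i < D"
        \<comment> \<open>Top positions are congruent to \<open>D\<close> modulo \<open>P\<close>,
          so lower coefficients are never omitted.\<close>
        have "j * P + i \<noteq> j' * P + D" for j'
        proof
          assume "j * P + i = j' * P + D"
          then have "(j * P + i) mod P = (j' * P + D) mod P" by simp
          then show False using i P by simp
        qed
        then have "j * P + i \<in> J" using idx[OF j, of i] i P by (auto simp: J_def tops_def)
        moreover have "j * P + i < t * P" using block[OF j, of i] i P by simp
        ultimately show "enc (v n) (j * P + i) \<ominus> enc (v n) (j * P + D) \<otimes> a d n i =
              enc (w n) (j * P + i) \<ominus> enc (w n) (j * P + D) \<otimes> a d n i"
          using fun_cong[OF Xeq, of "(n, j * P + i)"] n i P by (simp add: X_def)
      next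
        show "enc (v n) (j * P + i) \<in> carrier R" "enc (w n) (j * P + i) \<in> carrier R"
          if "n \<in> {1..N}" "i \<le> D" for n i
          using that v w idx[OF j] P_def by (auto intro!: enc_w)
      next
        show "peval D (a d n) (x k) = \<zero> \<longleftrightarrow> n \<noteq> d k" if "n \<in> {1..N}" for n
          using a(3)[OF d that k] by auto
      next
        show "a d n i \<in> carrier R" "a d n D = \<one>" if "n \<in> {1..N}" for n i
          using a(1,2)[OF d that] by blast+
        show "x k \<in> carrier R" using x(2) k by blast
      qed (use m in simp_all)
      then show ?thesis by (simp add: j_def)
    qed
    moreover have vw: "v (d k) \<in> A" "w (d k) \<in> A"
      using v w m by (auto dest: PiE_mem)
    moreover have "enc (v (d k)) \<in> extensional {..<T}" "enc (w (d k)) \<in> extensional {..<T}"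
      using enc(2) vw by (auto simp: PiE_def)
    ultimately have "enc (v (d k)) = enc (w (d k))"
      by (intro extensionalityI[where A = "{..<T}"]) auto
    then show "v (d k) = w (d k)"
      using enc(1) vw by (auto dest: inj_onD)
  qed (use A M in auto)
qed

section \<open>From symbol counts to memory and rate\<close>

text \<open>Relative to a file of \<open>T\<close> symbols over \<open>q\<close> values, a memory or
  rate \<open>c\<close> amounts to exactly \<open>m\<close> symbols.\<close>

lemma two_powr_mult_log:
  assumes "0 < q" "c * real T = real m"
  shows "2 powr (c * log 2 (real (q ^ T))) = real (q ^ m)"
proof -
  have "c * log 2 (real (q ^ T)) = log 2 (real q) * real m"
    using assms by (simp add: log_nat_power flip: assms(2))
  then show ?thesis
    using assms(1) by (simp add: powr_powr[symmetric] powr_realpow)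
qed

text \<open>With files made of field symbols there is no rounding: \<open>t\<close> cached symbols
  are exactly memory t / T, and N * (T - t) sent symbols exactly the stated rate.\<close>

lemma achievable_over_ratio:
  fixes \<FF> (structure)
  assumes "field \<FF>" and q: "finite (carrier \<FF>)" "K * N \<le> card (carrier \<FF>)"
    and N: "1 \<le> N" and T: "1 \<le> T" "t * (K * (N - 1) + 1) \<le> T"
  shows "achievable_over \<FF> N K (real t / real T) (real N * (1 - real t / real T))"
proof -
  interpret field \<FF> by fact
  let ?q = "card (carrier \<FF>)" and ?A = "{1..T} \<rightarrow>\<^sub>E carrier \<FF>"
  have "card {\<zero>, \<one>} \<le> ?q" using q by (intro card_mono) auto
  then have q2: "2 \<le> ?q" by simp
  have "t \<le> t * (K * (N - 1) + 1)" by simp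
  then have tT: "t \<le> T" using T(2) by linarith
  have card_A: "card ?A = ?q ^ T" using q by (simp add: card_PiE)
  have "\<exists>Z X. caching_scheme N K ?A (real t / real T) (real N * (1 - real t / real T)) Z X"
  proof (rule coded_caching_scheme[OF q _ _ _ T(2)])
    show "finite ?A" "card ?A \<le> ?q ^ T" using q card_A by (auto intro: finite_PiE)
    show "2 \<le> card ?A" unfolding card_A
      using q2 T(1) self_le_power[of ?q T] by linarith
    show "0 \<le> real t / real T" by simp
    have "real t / real T \<le> 1" using tT T by simp
    then show "real t / real T \<le> real N" using N by linarith
    show "real (?q ^ t) \<le> 2 powr (real t / real T * file_bits ?A)"
      unfolding file_bits_def card_A
      by (subst two_powr_mult_log[where m = t]) (use T q2 in auto)
    show "real (?q ^ (N * (T - t))) \<le> 2 powr (real N * (1 - real t / real T) * file_bits ?A)"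
      unfolding file_bits_def card_A
      by (subst two_powr_mult_log[where m = "N * (T - t)"])
         (use T q2 tT in \<open>auto simp: of_nat_diff field_simps\<close>)
  qed
  then show ?thesis unfolding achievable_over_def using T(1) by blast
qed

text \<open>Bit strings of length \<open>F\<close> are embedded into strings over a prime field; the rounding losses
  are bounded independently of \<open>F\<close> and vanish in the slack.\<close>

lemma achievable_small_cache:
  assumes N: "1 \<le> N" and M: "0 \<le> M" "M * real (K * (N - 1) + 1) \<le> 1"
  shows "achievable N K M (real N * (1 - M))"
  unfolding achievable_def
proof (intro allI impI)
  fix \<epsilon> :: real assume \<epsilon>: "\<epsilon> > 0"
  \<comment> \<open>A prime above \<open>K * N\<close> leaves a separate evaluation point for every
    user.\<close>
  obtain p :: nat where p: "prime p" "K * N < p" using bigger_prime by blast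
  then interpret residues_prime p "residue_ring (int p)"
    by unfold_locales simp_all
  interpret field "residue_ring (int p)" by (rule is_field)
  have p2: "2 \<le> p" using p(1) by (rule prime_ge_2_nat)
  define L where "L = log 2 (real p)"
  have L: "L > 0" using p2 by (simp add: L_def)
  have pow: "real (p ^ n) = 2 powr (real n * L)" for n
    using p2 two_powr_mult_log[of p "real n" 1 n] by (simp add: L_def)
  \<comment> \<open>Large enough for the slack \<epsilon> * F to absorb the rounding loss 2 * N * L
    bounded below.\<close>
  define F where "F = nat \<lceil>2 * real N * L / \<epsilon>\<rceil> + 1"
  have F: "F \<ge> 1" "2 * real N * L \<le> \<epsilon> * real F"
  proof -
    have "2 * real N * L / \<epsilon> \<le> real F" unfolding F_def by linarith
    then show "2 * real N * L \<le> \<epsilon> * real F" using \<epsilon> by (simp add: field_simps)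
  qed (simp add: F_def)
  let ?A = "{1..(2::nat) ^ F}"
  have bits: "file_bits ?A = real F" by (simp add: file_bits_def log_nat_power)
  \<comment> \<open>A symbol carries \<open>L\<close> bits. \<open>T\<close> is rounded up so that a
    file fits, and \<open>t\<close> down so that the cache stays within M * F bits.\<close>
  define T where "T = nat \<lceil>real F / L\<rceil>"
  define t where "t = nat \<lfloor>M * real F / L\<rfloor>"
  have "0 \<le> real F / L" "0 \<le> M * real F / L" using L M by auto
  then have T: "real F / L \<le> real T" "real T \<le> real F / L + 1"
    and t: "real t \<le> M * real F / L" "M * real F / L - 1 \<le> real t"
    unfolding T_def t_def by linarith+
  have "real (t * (K * (N - 1) + 1)) \<le> M * real F / L * real (K * (N - 1) + 1)"
    unfolding of_nat_mult using t by (intro mult_right_mono) auto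
  also have "\<dots> = M * real (K * (N - 1) + 1) * (real F / L)" by simp
  also have "\<dots> \<le> 1 * (real F / L)" using M(2) L by (intro mult_right_mono) auto
  also have "\<dots> \<le> real T" using T by simp
  finally have tP: "t * (K * (N - 1) + 1) \<le> T" by (simp only: of_nat_le_iff)
  have "t \<le> t * (K * (N - 1) + 1)" by simp
  then have tT: "t \<le> T" using tP by linarith
  have card: "card (carrier (residue_ring (int p))) = p" by (simp add: res_carrier_eq)
  have "\<exists>Z X. caching_scheme N K ?A M (real N * (1 - M) + \<epsilon>) Z X"
  proof (rule coded_caching_scheme[OF _ _ _ _ _ tP, unfolded card])
    show "finite (carrier (residue_ring (int p)))" by simp
    show "K * N \<le> p" using p by simp
    show "finite ?A" by simp
    show "2 \<le> card ?A" using self_le_power[of "2::nat" F] F by simp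
    have "real (2 ^ F) = 2 powr real F" by (simp add: powr_realpow)
    also have "\<dots> \<le> real (p ^ T)" unfolding pow using T L by (simp add: field_simps)
    finally show "card ?A \<le> p ^ T" by (simp only: of_nat_le_iff card_atLeastAtMost diff_Suc_1)
    show "0 \<le> M" by fact
    have "M * 1 \<le> M * real (K * (N - 1) + 1)" using M by (intro mult_left_mono) auto
    then show "M \<le> real N" using M(2) N by linarith
    show "real (p ^ t) \<le> 2 powr (M * file_bits ?A)"
      unfolding pow bits using t(1) L by (simp add: field_simps)
    \<comment> \<open>Each of the two roundings costs at most one symbol, together 2 * L bits per
      file.\<close>
    have "real (T - t) * L \<le> (real F / L + 1 - (M * real F / L - 1)) * L"
      using T t tT L by (intro mult_right_mono) (auto simp: of_nat_diff)
    also have "\<dots> = real F * (1 - M) + 2 * L" using L by (simp add: field_simps)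
    finally have "real N * (real (T - t) * L) \<le> real N * (real F * (1 - M) + 2 * L)"
      by (intro mult_left_mono) auto
    also have "\<dots> \<le> (real N * (1 - M) + \<epsilon>) * real F"
      using F(2) by (simp add: algebra_simps)
    finally show "real (p ^ (N * (T - t))) \<le> 2 powr ((real N * (1 - M) + \<epsilon>) * file_bits ?A)"
      unfolding pow bits by (simp add: mult.assoc)
  qed
  then show "\<exists>F\<ge>1. \<exists>Z X. caching_scheme N K {1..(2::nat) ^ F} M (real N * (1 - M) + \<epsilon>) Z X"
    using F(1) by blast
qed

theorem lemma1:
  fixes N K :: nat
  assumes "N \<ge> 1" and "K \<ge> 1"
  shows "(\<exists>q\<^sub>0. \<forall>\<FF> :: 'a ring. field \<FF> \<and> finite (carrier \<FF>) \<and> q\<^sub>0 \<le> card (carrier \<FF>) \<longrightarrow>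
            achievable_over \<FF> N K
              (1 / (real K * (real N - 1) + 1))
              (real N * (1 - 1 / (real K * (real N - 1) + 1))) \<and>
            (\<forall>M \<in> {0..1 / (real K * (real N - 1) + 1)} \<inter> \<rat>.
               achievable_over \<FF> N K M (real N * (1 - M)))) \<and>
         (\<forall>M \<in> {0..1 / (real K * (real N - 1) + 1)}.
            achievable N K M (real N * (1 - M)))"
proof -
  define P where "P = K * (N - 1) + 1"
  have P: "real K * (real N - 1) + 1 = real P" "P \<ge> 1"
    using assms(1) by (simp_all add: P_def of_nat_diff)
  have le: "M * real P \<le> 1" if "M \<le> 1 / real P" for M
    using that P(2) by (simp add: field_simps)
  have "achievable_over \<FF> N K (1 / real P) (real N * (1 - 1 / real P)) \<and>
      (\<forall>M \<in> {0..1 / real P} \<inter> \<rat>. achievable_over \<FF> N K M (real N * (1 - M)))"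
    if F: "field \<FF>" "finite (carrier \<FF>)" "K * N \<le> card (carrier \<FF>)" for \<FF> :: "'a ring"
  proof (intro conjI ballI)
    \<comment> \<open>A single block suffices: \<open>t = 1\<close> and
      \<open>T = P\<close>.\<close>
    show "achievable_over \<FF> N K (1 / real P) (real N * (1 - 1 / real P))"
      using achievable_over_ratio[OF F assms(1) P(2), of 1] by (simp add: P_def)
    fix M assume M: "M \<in> {0..1 / real P} \<inter> \<rat>"
    then have "M \<in> \<rat>" "\<bar>M\<bar> = M" by auto
    then obtain t T :: nat where tT: "T \<noteq> 0" "M = real t / real T"
      by (metis Rats_abs_nat_div_natE)
    \<comment> \<open>For M = t / T the bound on the memory says precisely that \<open>t\<close>
      blocks fit into \<open>T\<close> symbols.\<close>
    have "real (t * P) \<le> real T"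
      using le[of M] M tT by (simp add: field_simps)
    then have "t * (K * (N - 1) + 1) \<le> T" by (simp only: of_nat_le_iff P_def)
    then show "achievable_over \<FF> N K M (real N * (1 - M))"
      unfolding tT(2) using achievable_over_ratio[OF F assms(1)] tT(1) by simp
  qed
  moreover have "achievable N K M (real N * (1 - M))" if M: "M \<in> {0..1 / real P}" for M
  proof (rule achievable_small_cache[OF assms(1)])
    show "0 \<le> M" using M by simp
    show "M * real (K * (N - 1) + 1) \<le> 1" unfolding P_def[symmetric] using M by (intro le) simp
  qed
  \<comment> \<open>The threshold \<open>K * N\<close> on the field size provides distinct points
    for all users.\<close>
  ultimately show ?thesis
    unfolding P(1) by (intro conjI exI[of _ "K * N"] allI impI ballI) (simp_all only:)
qed

end
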